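(* Let $1\le k\le n$ and $m\ge0$ be integers. The number of permutations in $\mathcal{S}_n$ with exactly $k-1$ descents and exactly $m$ occurrences of the generalized pattern $(2\text{-}31)$ is equal to the coefficient of $q^m$ in $$\hat{E}_{k,n}(q)=q^{-k^2}\sum_{i=0}^{k-1}(-1)^i[k-i]^n q^{ki}\left(\binom{n}{i}q^{k-i}+\binom{n}{i-1}\right).$$
   Context: Here $[j]=1+q+\dots+q^{j-1}$ is the $q$-analog of $j$, and $\binom{n}{-1}=0$. A descent of $\pi=a_1\cdots a_n$ is an index $i$ with $a_i>a_{i+1}$. An occurrence of $(2\text{-}31)$ in $\pi$ is a pair of positions $i<j$ with $j+1\le n$ such that $a_{j+1}<a_i<a_j$ (the last two letters must be adjacent in $\pi$). *)

theory Defs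
  imports
    "HOL-Computational_Algebra.Formal_Laurent_Series"
    "HOL-Combinatorics.Permutations"
begin

text \<open>
  A permutation of \<open>{1..n}\<close> is a function \<open>\<pi>\<close> with \<open>\<pi> permutes {1..n}\<close>;
  its one-line notation is \<open>\<pi> 1, \<dots>, \<pi> n\<close>.
\<close>

definition descents :: "nat \<Rightarrow> (nat \<Rightarrow> nat) \<Rightarrow> nat set" where
  "descents n \<pi> = {i. 1 \<le> i \<and> i + 1 \<le> n \<and> \<pi> i > \<pi> (i + 1)}"

definition occurrences_2_31 :: "nat \<Rightarrow> (nat \<Rightarrow> nat) \<Rightarrow> (nat \<times> nat) set" where
  "occurrences_2_31 n \<pi> =
     {(i, j). 1 \<le> i \<and> i < j \<and> j + 1 \<le> n \<and> \<pi> (j + 1) < \<pi> i \<and> \<pi> i < \<pi> j}"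

text \<open>
  The formula for \<open>E_hat\<close> contains a negative power of \<open>q\<close>, so it is read in the
  ring of formal Laurent series in \<open>q\<close> over the integers.
\<close>

abbreviation q :: "int fls" where
  "q \<equiv> fls_X"

definition q_analog :: "nat \<Rightarrow> int fls" where
  "q_analog j = (\<Sum>r<j. q ^ r)"

text \<open>The lower index is an integer, so that \<open>binom n (- 1) = 0\<close>.\<close>

definition binom :: "nat \<Rightarrow> int \<Rightarrow> nat" where
  "binom n j = (if j < 0 then 0 else n choose nat j)"

definition E_hat :: "nat \<Rightarrow> nat \<Rightarrow> int fls" where
  "E_hat k n =
     fls_X_intpow (- (int k ^ 2)) *
     (\<Sum>i = 0..k - 1. (- 1) ^ i * q_analog (k - i) ^ n * q ^ (k * i) *
        (of_nat (binom n (int i)) * q ^ (k - i) + of_nat (binom n (int i - 1))))"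

end

theory Submission
  imports Defs
begin

text \<open>
  Build permutations by appending a last letter and bumping the earlier letters that are not smaller.
  Appending \<open>r\<close> after last letter \<open>l\<close> creates, if \<open>r \<le> l\<close>, one descent and one
  occurrence of (2-31) for each of the \<open>l - r\<close> letters between the two, and otherwise nothing. With
  \<open>y\<close> marking descents this gives the recurrence
  \<open>G\<^bsub>n+1\<^esub>(r) = (\<Sum>l<r. G\<^sub>n(l)) + y (\<Sum>l\<ge>r. q^(l-r) G\<^sub>n(l))\<close>, where \<open>l\<close> and \<open>r\<close> count from \<open>0\<close>.

  Looking for solutions \<open>\<lambda>^l x^(n-1-l)\<close> leads to a quadratic equation for \<open>x\<close>, which for
  \<open>\<lambda> = [j](1 - y q^(-j))\<close> has the roots \<open>[j](q - y q^(-j))\<close> and \<open>([j] - 1)(1 - y q^(-j))\<close>. A suitable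
  combination of the two satisfies the recurrence up to an error that telescopes in \<open>j\<close>, so
  that summing over \<open>j \<ge> 1\<close> solves it as a power series in \<open>y\<close>, and the sum of \<open>y G\<^sub>n(l)\<close> over \<open>l\<close> is
  \<open>\<Sum>j\<ge>1. y^j q^(-j^2) (q^j - y q^(-j)) ([j](1 - y q^(-j)))^n\<close>. The coefficient of \<open>y^k\<close> is the claimed sum
  with \<open>j = k - i\<close>. Infinite sums are avoided by working modulo powers of \<open>y\<close>.
\<close>

section \<open>Appending a last letter to a permutation\<close>

text \<open>The map acts on values and is composed after \<open>\<pi>\<close>. Since
  \<open>\<pi>\<close> fixes \<open>Suc n\<close>, the clause for \<open>Suc n\<close> is what makes
  \<open>r\<close> the new last letter.\<close>

definition insert_value :: "nat \<Rightarrow> nat \<Rightarrow> nat \<Rightarrow> nat" where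
  "insert_value n r i = (if i = Suc n then r else if r \<le> i \<and> i \<le> n then Suc i else i)"

lemma insert_value_permutes:
  assumes "r \<in> {1..Suc n}"
  shows "insert_value n r permutes {1..Suc n}"
proof (rule bij_imp_permutes)
  have inj: "inj_on (insert_value n r) {1..Suc n}"
    using assms by (auto simp: inj_on_def insert_value_def split: if_splits)
  moreover have "insert_value n r ` {1..Suc n} \<subseteq> {1..Suc n}"
    using assms by (auto simp: insert_value_def)
  ultimately show "bij_betw (insert_value n r) {1..Suc n} {1..Suc n}"
    by (simp add: bij_betw_def endo_inj_surj)
qed (use assms in \<open>auto simp: insert_value_def\<close>)

lemma bij_betw_append_letter:
  assumes r: "r \<in> {1..Suc n}"
  shows "bij_betw (\<lambda>\<pi>. insert_value n r \<circ> \<pi>) {\<pi>. \<pi> permutes {1..n}}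
           {\<sigma>. \<sigma> permutes {1..Suc n} \<and> \<sigma> (Suc n) = r}"
proof -
  let ?c = "insert_value n r"
  have c: "?c permutes {1..Suc n}"
    using r by (rule insert_value_permutes)
  have c_last: "?c (Suc n) = r"
    by (simp add: insert_value_def)
  show ?thesis
  proof (rule bij_betw_byWitness[where f' = "\<lambda>\<sigma>. inv ?c \<circ> \<sigma>"])
    show "\<forall>\<pi>\<in>{\<pi>. \<pi> permutes {1..n}}. inv ?c \<circ> (?c \<circ> \<pi>) = \<pi>"
      using permutes_inv_o(2)[OF c] by (simp add: o_assoc)
    show "\<forall>\<sigma>\<in>{\<sigma>. \<sigma> permutes {1..Suc n} \<and> \<sigma> (Suc n) = r}. ?c \<circ> (inv ?c \<circ> \<sigma>) = \<sigma>"
      using permutes_inv_o(1)[OF c] by (simp add: o_assoc)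
    show "(\<lambda>\<pi>. ?c \<circ> \<pi>) ` {\<pi>. \<pi> permutes {1..n}}
        \<subseteq> {\<sigma>. \<sigma> permutes {1..Suc n} \<and> \<sigma> (Suc n) = r}"
    proof safe
      fix \<pi> assume \<pi>: "\<pi> permutes {1..n}"
      then have "\<pi> permutes {1..Suc n}"
        by (rule permutes_subset) auto
      then show "(?c \<circ> \<pi>) permutes {1..Suc n}"
        using c by (rule permutes_compose)
      show "(?c \<circ> \<pi>) (Suc n) = r"
        using permutes_not_in[OF \<pi>, of "Suc n"] c_last by simp
    qed
    show "(\<lambda>\<sigma>. inv ?c \<circ> \<sigma>) ` {\<sigma>. \<sigma> permutes {1..Suc n} \<and> \<sigma> (Suc n) = r}
        \<subseteq> {\<pi>. \<pi> permutes {1..n}}"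
    proof safe
      fix \<sigma> assume \<sigma>: "\<sigma> permutes {1..Suc n}" and "r = \<sigma> (Suc n)"
      then have fix_last: "(inv ?c \<circ> \<sigma>) (Suc n) = Suc n"
        using c c_last by (metis comp_apply permutes_inverses(2))
      have "(inv ?c \<circ> \<sigma>) permutes {1..Suc n}"
        using \<sigma> permutes_inv[OF c] by (rule permutes_compose)
      then show "(inv (insert_value n (\<sigma> (Suc n))) \<circ> \<sigma>) permutes {1..n}"
        unfolding \<open>r = \<sigma> (Suc n)\<close>[symmetric]
        by (rule permutes_superset) (use fix_last in \<open>auto simp: le_Suc_eq\<close>)
    qed
  qed
qed

lemma finite_descents: "finite (descents n \<pi>)"
  by (rule finite_subset[of _ "{..n}"]) (auto simp: descents_def)

lemma finite_occurrences_2_31: "finite (occurrences_2_31 n \<pi>)"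
  by (rule finite_subset[of _ "{..n} \<times> {..n}"]) (auto simp: occurrences_2_31_def)

lemma insert_value_last: "insert_value n r (Suc n) = r"
  by (simp add: insert_value_def)

lemma insert_value_less_iff:
  assumes "i \<le> n" "j \<le> n"
  shows "insert_value n r i < insert_value n r j \<longleftrightarrow> i < j"
  using assms by (auto simp: insert_value_def)

lemma card_descents_append:
  assumes \<pi>: "\<pi> permutes {1..n}" and n: "n \<ge> 1"
  shows "card (descents (Suc n) (insert_value n r \<circ> \<pi>)) =
           card (descents n \<pi>) + (if r \<le> \<pi> n then 1 else 0)"
proof -
  have in_range: "\<pi> i \<le> n" "1 \<le> \<pi> i" if "1 \<le> i" "i \<le> n" for i
    using permutes_in_image[OF \<pi>, of i] that by auto
  have \<pi>_last: "\<pi> (Suc n) = Suc n"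
    using permutes_not_in[OF \<pi>, of "Suc n"] by simp
  have last_step: "r < insert_value n r (\<pi> n) \<longleftrightarrow> r \<le> \<pi> n"
    using in_range[of n] n by (auto simp: insert_value_def)
  have "descents (Suc n) (insert_value n r \<circ> \<pi>) =
          descents n \<pi> \<union> (if r \<le> \<pi> n then {n} else {})"
  proof (rule set_eqI)
    fix i
    consider "1 \<le> i" "Suc i \<le> n" | "i = n" | "\<not> (1 \<le> i \<and> i \<le> n)"
      by linarith
    then show "i \<in> descents (Suc n) (insert_value n r \<circ> \<pi>) \<longleftrightarrow>
        i \<in> descents n \<pi> \<union> (if r \<le> \<pi> n then {n} else {})"
    proof cases
      case 1
      then have "insert_value n r (\<pi> (Suc i)) < insert_value n r (\<pi> i) \<longleftrightarrow> \<pi> (Suc i) < \<pi> i"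
        using in_range by (intro insert_value_less_iff) auto
      then show ?thesis
        using 1 by (simp add: descents_def)
    next
      case 2
      then show ?thesis
        using n last_step by (simp add: descents_def \<pi>_last insert_value_last)
    next
      case 3
      then show ?thesis
        using n by (auto simp: descents_def)
    qed
  qed
  moreover have "n \<notin> descents n \<pi>"
    by (simp add: descents_def)
  ultimately show ?thesis
    by (simp add: finite_descents)
qed

text \<open>New occurrences end in the new adjacent pair, so \<open>j = n\<close>. Each old value
  from \<open>r\<close> up to \<open>\<pi> n - 1\<close> sits before position \<open>n\<close> and
  supplies one; truncated subtraction gives 0 when the pair ascends.\<close>

lemma card_occurrences_append:
  assumes \<pi>: "\<pi> permutes {1..n}" and n: "n \<ge> 1" and r: "1 \<le> r"
  shows "card (occurrences_2_31 (Suc n) (insert_value n r \<circ> \<pi>)) =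
           card (occurrences_2_31 n \<pi>) + (\<pi> n - r)"
proof -
  let ?\<sigma> = "insert_value n r \<circ> \<pi>"
  have in_range: "\<pi> i \<le> n" "1 \<le> \<pi> i" if "1 \<le> i" "i \<le> n" for i
    using permutes_in_image[OF \<pi>, of i] that by auto
  have \<pi>_last: "\<pi> (Suc n) = Suc n"
    using permutes_not_in[OF \<pi>, of "Suc n"] by simp
  let ?I = "{i. 1 \<le> i \<and> i < n \<and> r \<le> \<pi> i \<and> \<pi> i < \<pi> n}"
  have "occurrences_2_31 (Suc n) ?\<sigma> = occurrences_2_31 n \<pi> \<union> ?I \<times> {n}"
  proof (rule set_eqI, clarify)
    fix i j
    consider "1 \<le> i" "i < j" "Suc j \<le> n" | "1 \<le> i" "i < j" "j = n"
      | "\<not> (1 \<le> i \<and> i < j \<and> j \<le> n)"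
      by linarith
    then show "(i, j) \<in> occurrences_2_31 (Suc n) ?\<sigma> \<longleftrightarrow>
        (i, j) \<in> occurrences_2_31 n \<pi> \<union> ?I \<times> {n}"
    proof cases
      case 1
      then have "insert_value n r (\<pi> (Suc j)) < insert_value n r (\<pi> i) \<longleftrightarrow> \<pi> (Suc j) < \<pi> i"
        "insert_value n r (\<pi> i) < insert_value n r (\<pi> j) \<longleftrightarrow> \<pi> i < \<pi> j"
        using in_range by (intro insert_value_less_iff; simp)+
      then show ?thesis
        using 1 by (simp add: occurrences_2_31_def)
    next
      case 2
      then have "r < insert_value n r (\<pi> i) \<longleftrightarrow> r \<le> \<pi> i"
        using in_range[of i] by (auto simp: insert_value_def)
      moreover have "insert_value n r (\<pi> i) < insert_value n r (\<pi> j) \<longleftrightarrow> \<pi> i < \<pi> j"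
        using 2 in_range by (intro insert_value_less_iff) auto
      ultimately show ?thesis
        using 2 by (simp add: occurrences_2_31_def \<pi>_last insert_value_last)
    next
      case 3
      then show ?thesis
        by (auto simp: occurrences_2_31_def)
    qed
  qed
  moreover have "occurrences_2_31 n \<pi> \<inter> ?I \<times> {n} = {}"
    by (auto simp: occurrences_2_31_def)
  moreover have "card (?I \<times> {n}) = \<pi> n - r"
  proof -
    have "\<pi> ` ?I = {r..<\<pi> n}"
    proof (intro equalityI subsetI)
      fix v assume v: "v \<in> {r..<\<pi> n}"
      then have "v \<in> \<pi> ` {1..n}"
        using permutes_image[OF \<pi>] in_range[of n] n r by auto
      then obtain i where i: "i \<in> {1..n}" "v = \<pi> i"
        by auto
      moreover have "i \<noteq> n"
        using i v by auto
      ultimately show "v \<in> \<pi> ` ?I"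
        using v by auto
    qed auto
    moreover have "card (\<pi> ` ?I) = card ?I"
      using permutes_inj_on[OF \<pi>] by (rule card_image)
    ultimately show ?thesis
      by (simp add: card_cartesian_product)
  qed
  ultimately show ?thesis
    by (simp add: card_Un_disjoint finite_occurrences_2_31)
qed

section \<open>Generating functions by last letter\<close>

definition perm_weight :: "'a::comm_ring_1 \<Rightarrow> 'a \<Rightarrow> nat \<Rightarrow> (nat \<Rightarrow> nat) \<Rightarrow> 'a" where
  "perm_weight y t n \<pi> = y ^ card (descents n \<pi>) * t ^ card (occurrences_2_31 n \<pi>)"

text \<open>The last letter is \<open>Suc l\<close>, so that \<open>l\<close> ranges over \<open>{..<n}\<close>.\<close>

definition last_letter_gf :: "'a::comm_ring_1 \<Rightarrow> 'a \<Rightarrow> nat \<Rightarrow> nat \<Rightarrow> 'a" where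
  "last_letter_gf y t n l =
     (\<Sum>\<pi> | \<pi> permutes {1..n} \<and> \<pi> n = Suc l. perm_weight y t n \<pi>)"

lemma sum_last_letter:
  fixes f :: "(nat \<Rightarrow> nat) \<Rightarrow> 'a::comm_ring_1"
  assumes n: "n \<ge> 1"
  shows "(\<Sum>l<n. \<Sum>\<pi> | \<pi> permutes {1..n} \<and> \<pi> n = Suc l. f \<pi>) =
         (\<Sum>\<pi> | \<pi> permutes {1..n}. f \<pi>)"
proof -
  have "(\<Sum>l<n. \<Sum>\<pi> | \<pi> permutes {1..n} \<and> \<pi> n = Suc l. f \<pi>) =
        (\<Sum>l<n. sum f {\<pi> \<in> {\<pi>. \<pi> permutes {1..n}}. \<pi> n - 1 = l})"
  proof (intro sum.cong refl)
    fix l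
    \<comment> \<open>\<open>\<pi> n\<close> is positive, so the truncated predecessor loses nothing
      and can serve as the grouping key.\<close>
    have "\<pi> n = Suc l \<longleftrightarrow> \<pi> n - 1 = l" if "\<pi> permutes {1..n}" for \<pi>
      using permutes_in_image[OF that, of n] n by auto
    then show "{\<pi>. \<pi> permutes {1..n} \<and> \<pi> n = Suc l} =
        {\<pi> \<in> {\<pi>. \<pi> permutes {1..n}}. \<pi> n - 1 = l}"
      by auto
  qed
  also have "\<dots> = (\<Sum>\<pi> | \<pi> permutes {1..n}. f \<pi>)"
  proof (rule sum.group)
    show "finite {\<pi>. \<pi> permutes {1..n}}"
      by (rule finite_permutations) simp
    show "(\<lambda>\<pi>. \<pi> n - 1) ` {\<pi>. \<pi> permutes {1..n}} \<subseteq> {..<n}"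
    proof (rule image_subsetI)
      fix \<pi> assume "\<pi> \<in> {\<pi>. \<pi> permutes {1..n}}"
      then have "\<pi> n \<in> {1..n}"
        using n permutes_in_image[of \<pi> "{1..n}" n] by auto
      then show "\<pi> n - 1 \<in> {..<n}"
        using n by auto
    qed
  qed simp
  finally show ?thesis .
qed

lemma last_letter_gf_Suc:
  assumes n: "n \<ge> 1" and r: "r \<le> n"
  shows "last_letter_gf y t (Suc n) r =
    (\<Sum>l<r. last_letter_gf y t n l) + y * (\<Sum>l\<in>{r..<n}. t ^ (l - r) * last_letter_gf y t n l)"
proof -
  let ?S = "\<lambda>l. {\<pi>. \<pi> permutes {1..n} \<and> \<pi> n = Suc l}"
  let ?w = "\<lambda>\<pi>. perm_weight y t (Suc n) (insert_value n (Suc r) \<circ> \<pi>)"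
  have "last_letter_gf y t (Suc n) r = (\<Sum>\<pi> | \<pi> permutes {1..n}. ?w \<pi>)"
    unfolding last_letter_gf_def
    using r by (intro sum.reindex_bij_betw[symmetric] bij_betw_append_letter) auto
  also have "\<dots> = (\<Sum>l<n. \<Sum>\<pi>\<in>?S l. ?w \<pi>)"
    by (rule sum_last_letter[OF n, symmetric])
  also have "\<dots> = (\<Sum>l<n. if l < r then last_letter_gf y t n l
                      else y * (t ^ (l - r) * last_letter_gf y t n l))"
    by (intro sum.cong refl)
       (auto simp: last_letter_gf_def perm_weight_def sum_distrib_left card_descents_append
          card_occurrences_append n power_add mult_ac intro!: sum.cong)
  also have "{..<n} = {..<r} \<union> {r..<n}"
    using r by auto
  also have "(\<Sum>l\<in>{..<r} \<union> {r..<n}. if l < r then last_letter_gf y t n l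
                else y * (t ^ (l - r) * last_letter_gf y t n l)) =
      (\<Sum>l<r. last_letter_gf y t n l) + (\<Sum>l\<in>{r..<n}. y * (t ^ (l - r) * last_letter_gf y t n l))"
    by (subst sum.union_disjoint) (auto intro!: arg_cong2[of _ _ _ _ "(+)"] sum.cong)
  finally show ?thesis
    by (simp add: sum_distrib_left)
qed

section \<open>Telescoping solutions of the recurrence\<close>

text \<open>\<open>t\<close> plays the role of \<open>q\<close>, which is no longer a free name, and \<open>u\<close> that of its inverse.\<close>

locale q_inverse =
  fixes y t u :: "'a::comm_ring_1"
  assumes t_u: "t * u = 1"
begin

definition bracket :: "nat \<Rightarrow> 'a" where
  "bracket j = (\<Sum>r<j. t ^ r)"

text \<open>This is the \<lambda> of the ansatz; \<open>upper\<close> and \<open>lower\<close> are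
  the two roots for x.\<close>

definition eig :: "nat \<Rightarrow> 'a" where
  "eig j = bracket j * (1 - y * u ^ j)"

definition upper :: "nat \<Rightarrow> 'a" where
  "upper j = bracket j * (t - y * u ^ j)"

definition lower :: "nat \<Rightarrow> 'a" where
  "lower j = (bracket j - 1) * (1 - y * u ^ j)"

text \<open>The coefficients equal \<open>upper j - t * eig j\<close> and
  \<open>lower j - t * eig j\<close>, the denominators of the geometric sums over
  \<open>l \<ge> r\<close>. The prefactor is chosen so that the errors for consecutive
  \<open>j\<close> match.\<close>

definition mode :: "nat \<Rightarrow> nat \<Rightarrow> nat \<Rightarrow> 'a" where
  "mode j n l = y ^ j * u ^ (j * j) * eig j ^ l *
     ((y - y * u ^ j) * upper j ^ (n - Suc l) - (y - t ^ j) * lower j ^ (n - Suc l))"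

text \<open>\<open>leak n (Suc j) - leak n j\<close> is the error with which \<open>mode j\<close> satisfies the recurrence.\<close>

definition leak :: "nat \<Rightarrow> nat \<Rightarrow> 'a" where
  "leak n j = y ^ j * u ^ (j * j) * t ^ j * lower j ^ n"

lemma pow_t_u: "t ^ j * u ^ j = 1"
  by (simp add: t_u flip: power_mult_distrib)

lemma bracket_t: "t * bracket j = bracket j + t ^ j - 1"
  by (induction j) (auto simp: bracket_def algebra_simps)

lemma upper_minus_eig: "upper j - t * eig j = y - y * u ^ j"
proof -
  have "upper j - t * eig j = y * u ^ j * (t * bracket j - bracket j)"
    by (simp add: upper_def eig_def algebra_simps)
  also have "\<dots> = y * u ^ j * (t ^ j - 1)"
    by (simp only: bracket_t) simp
  also have "\<dots> = y * (t ^ j * u ^ j) - y * u ^ j"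
    by (simp add: algebra_simps)
  finally show ?thesis
    by (simp add: pow_t_u)
qed

lemma lower_minus_eig: "lower j - t * eig j = y - t ^ j"
proof -
  have "lower j - t * eig j = (bracket j - 1 - t * bracket j) * (1 - y * u ^ j)"
    by (simp add: lower_def eig_def algebra_simps)
  also have "\<dots> = - (t ^ j) * (1 - y * u ^ j)"
    by (simp only: bracket_t) simp
  also have "\<dots> = y * (t ^ j * u ^ j) - t ^ j"
    by (simp add: algebra_simps)
  finally show ?thesis
    by (simp add: pow_t_u)
qed

lemma eig_minus_upper: "u ^ j * (eig j - upper j) = u ^ j - 1"
proof -
  have "eig j - upper j = bracket j - t * bracket j"
    by (simp add: upper_def eig_def algebra_simps)
  also have "\<dots> = 1 - t ^ j"
    by (simp only: bracket_t) simp
  finally have "u ^ j * (eig j - upper j) = u ^ j - t ^ j * u ^ j"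
    by (simp only:) (simp add: algebra_simps)
  then show ?thesis
    by (simp only: pow_t_u)
qed

lemma eig_minus_lower: "t ^ j * (eig j - lower j) = t ^ j - y"
proof -
  have "eig j - lower j = 1 - y * u ^ j"
    by (simp add: lower_def eig_def algebra_simps)
  then have "t ^ j * (eig j - lower j) = t ^ j - y * (t ^ j * u ^ j)"
    by (simp only:) (simp add: algebra_simps)
  then show ?thesis
    by (simp add: pow_t_u)
qed

text \<open>A geometric sum, cleared of its denominator since the ring may lack division. The
  boundary term \<open>x ^ n\<close> is free of \<open>r\<close> and becomes a leak.\<close>

lemma sum_below:
  fixes e x :: 'a
  assumes "r \<le> n"
  shows "(e - x) * (\<Sum>l<r. e ^ l * x ^ (n - Suc l)) = e ^ r * x ^ (n - r) - x ^ n"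
proof -
  have "(e - x) * (\<Sum>l<r. e ^ l * x ^ (n - Suc l)) =
        (e - x) * (\<Sum>l<r. x ^ (r - Suc l) * e ^ l) * x ^ (n - r)"
    using assms by (auto simp: sum_distrib_left sum_distrib_right mult_ac
        simp flip: power_add intro!: sum.cong)
  also have "\<dots> = (e ^ r - x ^ r) * x ^ (n - r)"
    by (simp add: power_diff_sumr2)
  finally show ?thesis
    using assms by (simp add: algebra_simps flip: power_add)
qed

text \<open>The boundary term at \<open>l = n\<close> is free of \<open>x\<close>, so it cancels
  between the two roots in \<open>mode_sum_above\<close>.\<close>

lemma sum_above:
  fixes e x :: 'a
  assumes "r \<le> n"
  shows "(x - t * e) * (\<Sum>l\<in>{r..<n}. t ^ (l - r) * (e ^ l * x ^ (n - Suc l))) =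
         e ^ r * x ^ (n - r) - e ^ r * (t * e) ^ (n - r)"
proof -
  have "(\<Sum>l\<in>{r..<n}. t ^ (l - r) * (e ^ l * x ^ (n - Suc l))) =
        (\<Sum>i<n - r. t ^ i * (e ^ (i + r) * x ^ (n - r - Suc i)))"
    using assms sum.shift_bounds_nat_ivl[of "\<lambda>l. t ^ (l - r) * (e ^ l * x ^ (n - Suc l))" 0 r "n - r"]
    by (simp add: lessThan_atLeast0 add.commute)
  also have "\<dots> = e ^ r * (\<Sum>i<n - r. x ^ (n - r - Suc i) * (t * e) ^ i)"
    by (auto simp: sum_distrib_left power_add power_mult_distrib mult_ac intro!: sum.cong)
  finally have sum_eq: "(\<Sum>l\<in>{r..<n}. t ^ (l - r) * (e ^ l * x ^ (n - Suc l))) =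
      e ^ r * (\<Sum>i<n - r. x ^ (n - r - Suc i) * (t * e) ^ i)" .
  have "(x - t * e) * (e ^ r * T) = - (e ^ r) * ((t * e - x) * T)" for T
    by (simp add: algebra_simps)
  then have "(x - t * e) * (\<Sum>l\<in>{r..<n}. t ^ (l - r) * (e ^ l * x ^ (n - Suc l))) =
      - (e ^ r) * ((t * e - x) * (\<Sum>i<n - r. x ^ (n - r - Suc i) * (t * e) ^ i))"
    by (simp only: sum_eq)
  also have "\<dots> = - (e ^ r) * ((t * e) ^ (n - r) - x ^ (n - r))"
    by (simp only: power_diff_sumr2)
  finally show ?thesis
    by (simp add: algebra_simps)
qed

lemma mode_sum_below:
  assumes "r \<le> n"
  shows "(\<Sum>l<r. mode j n l) = y ^ j * u ^ (j * j) *
     (t ^ j * (eig j ^ r * lower j ^ (n - r) - lower j ^ n)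
      - y * u ^ j * (eig j ^ r * upper j ^ (n - r) - upper j ^ n))"
proof -
  have "(\<Sum>l<r. mode j n l) = y ^ j * u ^ (j * j) *
     ((t ^ j - y) * (\<Sum>l<r. eig j ^ l * lower j ^ (n - Suc l))
      - y * (u ^ j - 1) * (\<Sum>l<r. eig j ^ l * upper j ^ (n - Suc l)))"
    by (simp add: mode_def sum_distrib_left algebra_simps sum.distrib sum_subtractf)
  also have "\<dots> = y ^ j * u ^ (j * j) *
     (t ^ j * ((eig j - lower j) * (\<Sum>l<r. eig j ^ l * lower j ^ (n - Suc l)))
      - y * u ^ j * ((eig j - upper j) * (\<Sum>l<r. eig j ^ l * upper j ^ (n - Suc l))))"
    by (simp only: mult.assoc flip: eig_minus_lower eig_minus_upper)
  finally show ?thesis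
    using assms by (simp only: sum_below)
qed

lemma mode_sum_above:
  assumes "r \<le> n"
  shows "(\<Sum>l\<in>{r..<n}. t ^ (l - r) * mode j n l) = y ^ j * u ^ (j * j) * eig j ^ r *
     (upper j ^ (n - r) - lower j ^ (n - r))"
proof -
  have "(\<Sum>l\<in>{r..<n}. t ^ (l - r) * mode j n l) = y ^ j * u ^ (j * j) *
     ((y - y * u ^ j) * (\<Sum>l\<in>{r..<n}. t ^ (l - r) * (eig j ^ l * upper j ^ (n - Suc l)))
      - (y - t ^ j) * (\<Sum>l\<in>{r..<n}. t ^ (l - r) * (eig j ^ l * lower j ^ (n - Suc l))))"
    by (simp add: mode_def sum_distrib_left algebra_simps sum.distrib sum_subtractf)
  also have "\<dots> = y ^ j * u ^ (j * j) *
     ((eig j ^ r * upper j ^ (n - r) - eig j ^ r * (t * eig j) ^ (n - r))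
      - (eig j ^ r * lower j ^ (n - r) - eig j ^ r * (t * eig j) ^ (n - r)))"
    using assms by (simp only: sum_above flip: upper_minus_eig lower_minus_eig)
  finally show ?thesis
    by (simp add: algebra_simps)
qed

text \<open>Neighbouring indices share a root, which is what lets the errors telescope.\<close>

lemma lower_Suc: "lower (Suc j) = upper j"
proof -
  have "bracket (Suc j) - 1 = t * bracket j"
    by (simp add: bracket_t) (simp add: bracket_def)
  then have "lower (Suc j) = bracket j * (t - y * u ^ j * (t * u))"
    by (simp add: lower_def algebra_simps)
  then show ?thesis
    by (simp add: upper_def t_u)
qed

text \<open>The identity (j+1)^2 - (j+1) = j^2 + j explains the quadratic exponent of
  \<open>u\<close> in the prefactor.\<close>

lemma leak_Suc: "leak n (Suc j) = y ^ j * u ^ (j * j) * (y * u ^ j * upper j ^ n)"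
proof -
  have "u ^ (Suc j * Suc j) * t ^ Suc j = u ^ (j * j) * u ^ j * (t ^ Suc j * u ^ Suc j)"
    by (simp add: power_add algebra_simps)
  then have "u ^ (Suc j * Suc j) * t ^ Suc j = u ^ (j * j) * u ^ j"
    by (simp only: pow_t_u mult_1_right)
  moreover have "leak n (Suc j) =
      y * y ^ j * (u ^ (Suc j * Suc j) * t ^ Suc j) * upper j ^ n"
    by (simp only: leak_def lower_Suc power_Suc[of y] mult.assoc)
  ultimately show ?thesis
    by (simp add: mult_ac)
qed

text \<open>The terms containing \<open>eig j ^ r\<close> combine to the next mode; those free of
  \<open>r\<close> are the two leaks.\<close>

lemma mode_step:
  assumes "r \<le> n"
  shows "(\<Sum>l<r. mode j n l) + y * (\<Sum>l\<in>{r..<n}. t ^ (l - r) * mode j n l) =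
         mode j (Suc n) r + (leak n (Suc j) - leak n j)"
proof -
  have "mode j (Suc n) r = y ^ j * u ^ (j * j) * eig j ^ r *
     ((y - y * u ^ j) * upper j ^ (n - r) - (y - t ^ j) * lower j ^ (n - r))"
    by (simp add: mode_def)
  then show ?thesis
    using assms
    by (simp add: mode_sum_below mode_sum_above leak_Suc) (simp add: leak_def algebra_simps)
qed

lemma leak_1: "n \<ge> 1 \<Longrightarrow> leak n 1 = 0"
  by (simp add: zero_power leak_def lower_def bracket_def)

lemma dvd_leak_Suc: "y ^ Suc J dvd leak n (Suc J)"
  by (simp only: leak_def mult.assoc dvd_triv_left)

text \<open>Cutting the sum at \<open>J\<close> leaves only the outer leak with index
  \<open>Suc J\<close>, which is divisible by \<open>y ^ Suc J\<close>; the inner one vanishes by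
  \<open>leak_1\<close>.\<close>

lemma last_letter_gf_cong:
  assumes "n \<ge> 1" "l < n"
  shows "y ^ Suc J dvd y * last_letter_gf y t n l - (\<Sum>j=1..J. mode j n l)"
  using assms
proof (induction n arbitrary: l rule: dec_induct)
  case base
  \<comment> \<open>At length 1 the modes telescope by themselves. Their sum starts with
    \<open>leak 0 1 = y\<close>, whence the factor \<open>y\<close> in front of the generating
    function.\<close>
  have "mode j 1 0 = leak 0 j - leak 0 (Suc j)" for j
    by (simp only: leak_Suc) (simp add: mode_def leak_def algebra_simps)
  then have "(\<Sum>j=1..J. mode j 1 0) = - (\<Sum>j=1..J. leak 0 (Suc j) - leak 0 j)"
    by (simp flip: sum_negf)
  then have "(\<Sum>j=1..J. mode j 1 0) = leak 0 1 - leak 0 (Suc J)"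
    by (simp add: sum_Suc_diff)
  moreover have "leak 0 1 = y"
    by (simp add: leak_def t_u mult.commute[of u] mult.assoc)
  moreover have "last_letter_gf y t 1 0 = 1"
  proof -
    have "{\<pi>. \<pi> permutes {1..1::nat} \<and> \<pi> 1 = Suc 0} = {id}"
      by auto
    moreover have "descents 1 id = {}" "occurrences_2_31 1 id = {}"
      by (auto simp: descents_def occurrences_2_31_def)
    ultimately show ?thesis
      by (simp add: last_letter_gf_def perm_weight_def)
  qed
  ultimately show ?case
    using dvd_leak_Suc[of J 0] base by simp
next
  case (step n)
  have n: "n \<ge> 1" and l: "l \<le> n"
    using step by auto
  let ?G = "last_letter_gf y t n" and ?M = "\<lambda>l. \<Sum>j=1..J. mode j n l"
  have "(\<Sum>j=1..J. mode j (Suc n) l) + leak n (Suc J) =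
        (\<Sum>j=1..J. mode j (Suc n) l + (leak n (Suc j) - leak n j))"
    using leak_1[OF n] by (simp add: sum.distrib sum_Suc_diff)
  also have "\<dots> = (\<Sum>l'<l. ?M l') + y * (\<Sum>l'\<in>{l..<n}. t ^ (l' - l) * ?M l')"
    unfolding mode_step[OF l, symmetric]
    by (simp only: sum.distrib sum_distrib_left sum.swap[of _ _ "{1..J}"])
  finally have "y * last_letter_gf y t (Suc n) l - (\<Sum>j=1..J. mode j (Suc n) l) =
      (\<Sum>l'<l. y * ?G l' - ?M l') + y * (\<Sum>l'\<in>{l..<n}. t ^ (l' - l) * (y * ?G l' - ?M l'))
      + leak n (Suc J)"
    by (simp add: last_letter_gf_Suc[OF n l] algebra_simps sum_subtractf sum_distrib_left)
  moreover have "y ^ Suc J dvd (\<Sum>l'<l. y * ?G l' - ?M l')"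
    using l by (intro dvd_sum step.IH) auto
  moreover have "y ^ Suc J dvd y * (\<Sum>l'\<in>{l..<n}. t ^ (l' - l) * (y * ?G l' - ?M l'))"
    by (intro dvd_mult dvd_sum step.IH) auto
  ultimately show ?case
    using dvd_leak_Suc[of J n] by simp
qed

lemma total_gf_cong:
  assumes n: "n \<ge> 1"
  shows "y ^ Suc J dvd y * (\<Sum>\<pi> | \<pi> permutes {1..n}. perm_weight y t n \<pi>) -
    (\<Sum>j=1..J. y ^ j * u ^ (j * j) * bracket j ^ n * ((t ^ j - y * u ^ j) * (1 - y * u ^ j) ^ n))"
proof -
  \<comment> \<open>Appending the largest letter creates neither a descent nor an occurrence, so
    this one value is the total over all permutations of length \<open>n\<close>.\<close>
  have "last_letter_gf y t (Suc n) n = (\<Sum>\<pi> | \<pi> permutes {1..n}. perm_weight y t n \<pi>)"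
    unfolding last_letter_gf_Suc[OF n order.refl]
    using n by (simp add: last_letter_gf_def sum_last_letter del: One_nat_def)
  moreover have "mode j (Suc n) n =
      y ^ j * u ^ (j * j) * bracket j ^ n * ((t ^ j - y * u ^ j) * (1 - y * u ^ j) ^ n)" for j
    by (simp add: mode_def eig_def power_mult_distrib mult_ac)
  ultimately show ?thesis
    using last_letter_gf_cong[of "Suc n" n J] by simp
qed

end

section \<open>Extraction of coefficients\<close>

lemma coeff_perm_weight_sum:
  "fls_nth (coeff (\<Sum>\<pi> | \<pi> permutes {1..n}. perm_weight (monom 1 1) [:q:] n \<pi>) d) (int m) =
     int (card {\<pi>. \<pi> permutes {1..n} \<and> card (descents n \<pi>) = d
                     \<and> card (occurrences_2_31 n \<pi>) = m})"
proof -
  have weight: "perm_weight (monom 1 1) [:q:] n \<pi> =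
      monom (q ^ card (occurrences_2_31 n \<pi>)) (card (descents n \<pi>))" for \<pi>
    by (simp add: perm_weight_def monom_power mult.commute smult_monom poly_const_pow)
  have "fls_nth (coeff (\<Sum>\<pi> | \<pi> permutes {1..n}. perm_weight (monom 1 1) [:q:] n \<pi>) d) (int m) =
      (\<Sum>\<pi> | \<pi> permutes {1..n}.
         if card (descents n \<pi>) = d \<and> card (occurrences_2_31 n \<pi>) = m then 1 else 0)"
    unfolding weight by (auto simp: coeff_sum fls_nth_sum intro!: sum.cong)
  also have "\<dots> = int (card {\<pi> \<in> {\<pi>. \<pi> permutes {1..n}}.
      card (descents n \<pi>) = d \<and> card (occurrences_2_31 n \<pi>) = m})"
    by (simp add: finite_permutations flip: sum.inter_filter)
  finally show ?thesis
    by simp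
qed

lemma q_times_inverse: "q * fls_X_inv = 1"
  by (subst fls_X_inv_times_conv_shift(2)) simp

text \<open>In polynomials in y over Laurent series, q is an invertible constant and divisibility by
  a power of y says that the lower coefficients vanish.\<close>

interpretation q_poly: q_inverse "monom 1 1" "[:q:]" "[:fls_X_inv:]"
  by unfold_locales (simp add: q_times_inverse mult.commute[of fls_X_inv] one_pCons)

lemma bracket_q: "q_poly.bracket j = [:q_analog j:]"
  by (induction j) (auto simp: q_poly.bracket_def q_analog_def poly_const_pow)

lemma coeff_linear_factors:
  fixes a b :: "'a::comm_ring_1"
  assumes "i \<le> n"
  shows "coeff ([:b, - a:] * [:1, - a:] ^ n) i =
    (- 1) ^ i * a ^ i * (of_nat (binom n (int i)) * b + of_nat (binom n (int i - 1)))"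
proof (cases i)
  \<comment> \<open>The linear term of the first factor cannot contribute here, in agreement with
    \<open>binom n (- 1) = 0\<close>.\<close>
  case 0
  then show ?thesis
    using assms by (simp add: coeff_linear_poly_power binom_def)
next
  case (Suc i')
  have "(- a) ^ l = (- 1) ^ l * a ^ l" for l
    by (rule power_minus)
  moreover have "nat (1 + int i') = Suc i'"
    by simp
  ultimately show ?thesis
    using Suc assms by (simp add: coeff_linear_poly_power binom_def algebra_simps)
qed

lemma q_power_inverse: "fls_X_inv ^ (i + j) * q ^ i = (fls_X_inv ^ j :: int fls)"
proof -
  have "fls_X_inv ^ (i + j) * q ^ i = (q * fls_X_inv) ^ i * fls_X_inv ^ j"
    by (simp only: power_add power_mult_distrib mult_ac)
  then show ?thesis
    by (simp only: q_times_inverse) simp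
qed

lemma E_hat_eq_coeff:
  assumes "1 \<le> k" "k \<le> n"
  shows "E_hat k n = coeff (\<Sum>j=1..k. monom 1 1 ^ j * [:fls_X_inv:] ^ (j * j) * q_poly.bracket j ^ n *
     (([:q:] ^ j - monom 1 1 * [:fls_X_inv:] ^ j) * (1 - monom 1 1 * [:fls_X_inv:] ^ j) ^ n)) k"
    (is "_ = coeff (\<Sum>j=1..k. ?Q j) k")
proof -
  let ?summand = "\<lambda>i. (- 1) ^ i * q_analog (k - i) ^ n * q ^ (k * i) *
        (of_nat (binom n (int i)) * q ^ (k - i) + of_nat (binom n (int i - 1)))"
  have summand: "coeff (?Q (k - i)) k = fls_X_inv ^ (k * k) * ?summand i" if "i < k" for i
  proof -
    let ?j = "k - i" and ?x = "fls_X_inv :: int fls"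
    have "?Q ?j = monom (?x ^ (?j * ?j) * q_analog ?j ^ n) ?j *
        ([:q ^ ?j, - (?x ^ ?j):] * [:1, - (?x ^ ?j):] ^ n)"
      by (simp add: bracket_q monom_power poly_const_pow smult_monom monom_altdef one_pCons
          mult.commute)
    then have "coeff (?Q ?j) k = ?x ^ (?j * ?j) * q_analog ?j ^ n *
        coeff ([:q ^ ?j, - (?x ^ ?j):] * [:1, - (?x ^ ?j):] ^ n) i"
      using that by (simp only: coeff_monom_mult) simp
    also have "\<dots> = ?x ^ (?j * ?j + ?j * i) * ((- 1) ^ i * q_analog ?j ^ n *
        (of_nat (binom n (int i)) * q ^ ?j + of_nat (binom n (int i - 1))))"
    proof -
      have "i \<le> n"
        using that assms by simp
      then have "coeff ([:q ^ ?j, - (?x ^ ?j):] * [:1, - (?x ^ ?j):] ^ n) i =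
          (- 1) ^ i * ?x ^ (?j * i) *
          (of_nat (binom n (int i)) * q ^ ?j + of_nat (binom n (int i - 1)))"
        by (simp only: coeff_linear_factors power_mult)
      then show ?thesis
        by (simp only: power_add mult_ac)
    qed
    \<comment> \<open>The total exponent is kj = k^2 - ki, which splits the power of the inverse
      into the prefactor q^(-k^2) and the factor q^(ki).\<close>
    also have "?j * ?j + ?j * i = k * ?j"
      using that by (simp flip: add_mult_distrib2)
    also have "?x ^ (k * ?j) = ?x ^ (k * k) * q ^ (k * i)"
      using q_power_inverse[of "k * i" "k * ?j"] that by (simp flip: add_mult_distrib2)
    finally show ?thesis
      by (simp only: mult_ac)
  qed
  have "E_hat k n = (\<Sum>i=0..k - 1. fls_X_inv ^ (k * k) * ?summand i)"
    by (simp add: E_hat_def sum_distrib_left fls_X_inv_power_conv_shift_1 power2_eq_square)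
  also have "\<dots> = (\<Sum>i=0..k - 1. coeff (?Q (k - i)) k)"
    using assms by (intro sum.cong refl summand[symmetric]) auto
  also have "\<dots> = (\<Sum>j=1..k. coeff (?Q j) k)"
    using assms by (intro sum.reindex_bij_witness[of _ "\<lambda>j. k - j" "\<lambda>i. k - i"]) auto
  finally show ?thesis
    by (simp only: coeff_sum)
qed

theorem corollary30:
  fixes k n m :: nat
  assumes "1 \<le> k" and "k \<le> n"
  shows "int (card {\<pi>. \<pi> permutes {1..n} \<and> card (descents n \<pi>) = k - 1
                        \<and> card (occurrences_2_31 n \<pi>) = m})
         = fls_nth (E_hat k n) (int m)"
proof -
  let ?W = "\<Sum>\<pi> | \<pi> permutes {1..n}. perm_weight (monom 1 1) [:q:] n \<pi>"
  \<comment> \<open>Cutting at \<open>J = k\<close> suffices: a congruence modulo y^(k+1) fixes the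
    coefficient of y^k.\<close>
  have "monom 1 (Suc k) dvd monom 1 1 * ?W -
    (\<Sum>j=1..k. monom 1 1 ^ j * [:fls_X_inv:] ^ (j * j) * q_poly.bracket j ^ n *
      (([:q:] ^ j - monom 1 1 * [:fls_X_inv:] ^ j) * (1 - monom 1 1 * [:fls_X_inv:] ^ j) ^ n))"
    using q_poly.total_gf_cong[of n k] assms by (simp add: monom_power del: power_Suc)
  then have "coeff (monom 1 1 * ?W) k = E_hat k n"
    unfolding E_hat_eq_coeff[OF assms] monom_1_dvd_iff' by simp
  \<comment> \<open>The extra factor y shifts the degree from \<open>k\<close> to
    \<open>k - 1\<close> descents.\<close>
  then have "coeff ?W (k - 1) = E_hat k n"
    using assms by (simp add: coeff_monom_mult)
  then show ?thesis
    by (simp only: flip: coeff_perm_weight_sum)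
qed

end
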